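(* For every integer $d\geq 1$ and $\varepsilon \in (0,1)$ there exists an integer $p = p(\varepsilon, d)$ such that the following holds for every $N$. For every continuous map $f : \Delta^N \to \mathbb{R}^d$ there exist $p$ points $y_1, \dots, y_p \in \mathbb{R}^d$ such that $f^{-1}(y_1) \cup \cdots \cup f^{-1}(y_p)$ intersects every face of $\Delta^N$ of dimension $\lceil \varepsilon N \rceil$.
   Context: $\Delta^N$ denotes the $N$-dimensional simplex. *)

theory Defs
  imports "HOL-Analysis.Analysis" "HOL-Homology.Simplices"
begin

(* The vertices of standard_simplex N are the unit vectors e_i with i \<le> N. A face of dimension k
   is spanned by k + 1 of them, i.e. it consists of the points of the simplex whose
   barycentric coordinates vanish off a set S of k + 1 indices. *)
definition simplex_face :: "nat \<Rightarrow> nat \<Rightarrow> (nat \<Rightarrow> real) set \<Rightarrow> bool" where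
  "simplex_face N k F \<longleftrightarrow>
    (\<exists>S. S \<subseteq> {..N} \<and> card S = k + 1 \<and> F = {x \<in> standard_simplex N. \<forall>i. i \<notin> S \<longrightarrow> x i = 0})"

end

theory Submission
  imports Defs
begin

text \<open>Selection: for every continuous \<open>f\<close> some point \<open>y\<close> is hit by the faces spanned by a positive
  fraction \<open>c(d)\<close> of all \<open>2 ^ d\<close>-tuples of vertices. If not, vertices of the simplex can be assigned to the
  points of a fine cubical grid in \<open>\<real>\<^sup>d\<close> such that no grid cell meets the image of the face spanned by the
  vertices assigned to its corners; interpolation gives a map \<open>h\<close> back to the simplex such that \<open>f \<circ> h\<close>
  has no fixed point, against Brouwer. The points \<open>y\<^sub>i\<close> are then picked greedily: while a face of
  dimension \<open>\<lceil>\<epsilon>N\<rceil>\<close> is missed, selection within that face gives a point hit by a further fraction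
  at least \<open>c(d) \<epsilon> ^ (2 ^ d)\<close> of all tuples, which can happen only boundedly often.\<close>

section \<open>Averages over independent uniform choices of coordinates\<close>

definition mean_at :: "'x set \<Rightarrow> 'v \<Rightarrow> (('v \<Rightarrow> 'x) \<Rightarrow> real) \<Rightarrow> ('v \<Rightarrow> 'x) \<Rightarrow> real" where
  "mean_at X v g = (\<lambda>a. (\<Sum>x\<in>X. g (a(v := x))) / card X)"

text \<open>The expectation of \<open>g\<close> when the coordinates in \<open>V\<close> are drawn
  independently and uniformly from \<open>X\<close> and the others are kept. Folding over
  \<open>V\<close> makes conditional expectations available by peeling off one coordinate.\<close>

definition mean_over :: "'x set \<Rightarrow> 'v set \<Rightarrow> (('v \<Rightarrow> 'x) \<Rightarrow> real) \<Rightarrow> ('v \<Rightarrow> 'x) \<Rightarrow> real" where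
  "mean_over X V g = Finite_Set.fold (mean_at X) g V"

lemma mean_at_commute: "mean_at X v (mean_at X w g) = mean_at X w (mean_at X v g)"
proof (cases "v = w")
  case False
  have "(\<Sum>x\<in>X. \<Sum>y\<in>X. g (a(v := x, w := y))) = (\<Sum>y\<in>X. \<Sum>x\<in>X. g (a(w := y, v := x)))" for a
    by (subst sum.swap) (simp add: fun_upd_twist[OF False])
  then show ?thesis
    by (simp add: mean_at_def fun_eq_iff flip: sum_divide_distrib)
qed simp

interpretation mean_at: comp_fun_commute "mean_at X"
  by standard (simp add: fun_eq_iff mean_at_commute)

lemma mean_over_empty [simp]: "mean_over X {} g = g"
  by (simp add: mean_over_def)

lemma mean_over_insert:
  assumes "finite V" "v \<notin> V"
  shows "mean_over X (insert v V) g a = (\<Sum>x\<in>X. mean_over X V g (a(v := x))) / card X"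
proof -
  have "mean_over X (insert v V) g = mean_at X v (mean_over X V g)"
    using assms by (simp add: mean_over_def)
  then show ?thesis by (simp add: mean_at_def)
qed

text \<open>Only assignments that enter the average are compared, so a comparison may use that
  \<open>t\<close> takes its values on \<open>V\<close> in \<open>X\<close>.\<close>

lemma mean_over_mono:
  assumes "finite V"
    and "\<And>t. (\<And>v. v \<in> V \<Longrightarrow> t v \<in> X) \<Longrightarrow> (\<And>v. v \<notin> V \<Longrightarrow> t v = a v) \<Longrightarrow> g t \<le> h t"
  shows "mean_over X V g a \<le> mean_over X V h a"
  using assms
proof (induction V arbitrary: a rule: finite_induct)
  case empty
  then show ?case by simp
next
  case (insert v V)
  have "mean_over X V g (a(v := x)) \<le> mean_over X V h (a(v := x))" if "x \<in> X" for x
  proof (rule insert.IH)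
    fix t assume t: "\<And>w. w \<in> V \<Longrightarrow> t w \<in> X" "\<And>w. w \<notin> V \<Longrightarrow> t w = (a(v := x)) w"
    show "g t \<le> h t"
      using t that insert.hyps(2) by (intro insert.prems) (force split: if_splits)+
  qed
  then show ?case
    using insert.hyps by (auto simp: mean_over_insert intro!: divide_right_mono sum_mono)
qed

lemma mean_over_const:
  assumes "finite V" "finite X" "X \<noteq> {}"
  shows "mean_over X V (\<lambda>_. c) a = c"
  using assms(1)
proof (induction V arbitrary: a rule: finite_induct)
  case empty
  then show ?case by simp
next
  case (insert v V)
  then show ?case using assms by (simp add: mean_over_insert)
qed

lemma mean_over_nonneg:
  assumes "finite V" "\<And>t. 0 \<le> g t"
  shows "0 \<le> mean_over X V g a"
  using assms(1)
proof (induction V arbitrary: a rule: finite_induct)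
  case empty
  then show ?case using assms by simp
next
  case (insert v V)
  then show ?case by (simp add: mean_over_insert sum_nonneg)
qed

lemma mean_over_add:
  assumes "finite V"
  shows "mean_over X V (\<lambda>t. g t + h t) a = mean_over X V g a + mean_over X V h a"
  using assms
proof (induction V arbitrary: a rule: finite_induct)
  case empty
  then show ?case by simp
next
  case (insert v V)
  then show ?case by (simp add: mean_over_insert sum.distrib add_divide_distrib del: fun_upd_apply)
qed

text \<open>Assignments with all values in \<open>Y\<close> make up the fraction
  \<open>(card Y / card X) ^ card V\<close> of all assignments; the others contribute nonnegative
  terms.\<close>

lemma mean_over_subset:
  assumes "finite V" "finite X" "Y \<subseteq> X" "Y \<noteq> {}" and g: "\<And>t. 0 \<le> g t"
  shows "(card Y / card X) ^ card V * mean_over Y V g a \<le> mean_over X V g a"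
  using assms(1)
proof (induction V arbitrary: a rule: finite_induct)
  case empty
  then show ?case by simp
next
  case (insert v V)
  let ?q = "real (card Y) / card X"
  have fY: "card Y > 0" using assms by (meson card_gt_0_iff finite_subset)
  have "?q ^ card (insert v V) * mean_over Y (insert v V) g a
      = (\<Sum>y\<in>Y. ?q ^ card V * mean_over Y V g (a(v := y))) / card X"
    using insert.hyps fY by (simp add: mean_over_insert sum_distrib_left[symmetric])
  also have "\<dots> \<le> (\<Sum>y\<in>Y. mean_over X V g (a(v := y))) / card X"
    by (intro divide_right_mono sum_mono insert.IH) simp
  also have "\<dots> \<le> (\<Sum>y\<in>X. mean_over X V g (a(v := y))) / card X"
    using assms insert.hyps by (intro divide_right_mono sum_mono2 mean_over_nonneg) auto
  finally show ?case using insert.hyps by (simp add: mean_over_insert)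
qed

text \<open>Coordinates outside the range of \<open>\<kappa>\<close> average out, and injectivity
  matches the others one to one with the arguments of \<open>G\<close>. This reduces an average over
  labellings of a whole grid to one over the corners of a single cube.\<close>

lemma mean_over_comp:
  fixes \<kappa> :: "'c \<Rightarrow> 'v" and G :: "('c \<Rightarrow> 'x) \<Rightarrow> real"
  assumes "finite V" "finite X" "X \<noteq> {}" and \<kappa>: "inj \<kappa>"
  shows "mean_over X V (\<lambda>a. G (a \<circ> \<kappa>)) a = mean_over X (\<kappa> -` V) G (a \<circ> \<kappa>)"
  using assms(1)
proof (induction V arbitrary: a rule: finite_induct)
  case empty
  then show ?case by simp
next
  case (insert v V)
  show ?case
  proof (cases "v \<in> range \<kappa>")
    case True
    then obtain c where c: "v = \<kappa> c" by auto
    have "a(v := x) \<circ> \<kappa> = (a \<circ> \<kappa>)(c := x)" for a :: "'v \<Rightarrow> 'x" and x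
      using \<kappa> c by (auto simp: fun_eq_iff inj_eq)
    moreover have "\<kappa> -` insert v V = insert c (\<kappa> -` V)" "c \<notin> \<kappa> -` V" "finite (\<kappa> -` V)"
      using \<kappa> c insert.hyps by (auto simp: inj_eq finite_vimageI)
    ultimately show ?thesis
      using insert by (simp add: mean_over_insert del: fun_upd_apply o_apply)
  next
    case False
    then have "a(v := x) \<circ> \<kappa> = a \<circ> \<kappa>" for a :: "'v \<Rightarrow> 'x" and x
      by (auto simp: fun_eq_iff)
    moreover have "\<kappa> -` insert v V = \<kappa> -` V" using False by auto
    ultimately show ?thesis
      using insert assms by (simp add: mean_over_insert del: fun_upd_apply o_apply)
  qed
qed

lemma mean_over_irrelevant_upd:
  assumes "finite V" and g: "\<And>a x. g (a(v := x)) = g a"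
  shows "mean_over X V g (a(v := x)) = mean_over X V g a"
  using assms(1)
proof (induction V arbitrary: a rule: finite_induct)
  case empty
  show ?case using g by (simp del: fun_upd_apply)
next
  case (insert w V)
  have "mean_over X V g (a(v := x, w := y)) = mean_over X V g (a(w := y))" for y
    using insert.IH[of "a(w := y)"] by (cases "v = w") (simp_all add: fun_upd_twist[of v w] del: fun_upd_apply)
  then show ?case using insert.hyps by (simp add: mean_over_insert del: fun_upd_apply)
qed

section \<open>Keeping many local functions small by one assignment\<close>

text \<open>A union bound of Markov type: if every \<open>x\<close> violated some bound, the sum of
  the ratios \<open>h i x / m i\<close> would exceed \<open>D\<close> everywhere, but its mean over
  \<open>X\<close> is at most \<open>card I\<close>.\<close>

lemma mean_simultaneous_bound:
  fixes h :: "'i \<Rightarrow> 'x \<Rightarrow> real"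
  assumes I: "finite I" "card I \<le> D" and X: "finite X" "X \<noteq> {}"
    and nn: "\<And>i x. 0 \<le> h i x"
  shows "\<exists>x\<in>X. \<forall>i\<in>I. h i x \<le> D * ((\<Sum>x\<in>X. h i x) / card X)"
proof (rule ccontr)
  define m where "m i = (\<Sum>x\<in>X. h i x) / card X" for i
  assume "\<not> ?thesis"
  then have bad: "\<exists>i\<in>I. h i x > D * m i" if "x \<in> X" for x
    using that by (force simp: m_def not_le)
  have cX: "real (card X) > 0" using X by (simp add: card_gt_0_iff)
  have m0: "m i \<ge> 0" for i using nn by (simp add: m_def sum_nonneg)
  have "real D < (\<Sum>i\<in>I. h i x / m i)" if x: "x \<in> X" for x
  proof -
    obtain i where i: "i \<in> I" "h i x > D * m i" using bad x by blast
    have "m i \<noteq> 0"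
    proof
      assume "m i = 0"
      then have "(\<Sum>x\<in>X. h i x) = 0" using cX by (simp add: m_def)
      then have "h i x = 0" using X nn x by (simp add: sum_nonneg_eq_0_iff)
      then show False using i m0[of i] by (metis \<open>m i = 0\<close> mult_zero_right less_irrefl)
    qed
    then have "real D < h i x / m i" using i m0[of i] by (simp add: pos_less_divide_eq)
    also have "\<dots> \<le> (\<Sum>i\<in>I. h i x / m i)"
      using i I nn m0 by (intro member_le_sum) auto
    finally show ?thesis .
  qed
  then have "(\<Sum>x\<in>X. real D) < (\<Sum>x\<in>X. \<Sum>i\<in>I. h i x / m i)"
    using X by (intro sum_strict_mono) auto
  also have "\<dots> = (\<Sum>i\<in>I. (\<Sum>x\<in>X. h i x) / m i)"
    by (subst sum.swap) (simp add: sum_divide_distrib)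
  \<comment> \<open>Only an inequality: indices with \<open>m i = 0\<close> contribute 0, as
    division by zero gives 0.\<close>
  also have "\<dots> \<le> (\<Sum>i\<in>I. real (card X))"
    using cX by (intro sum_mono) (auto simp: m_def)
  also have "\<dots> \<le> D * real (card X)"
    using I by (simp add: mult_right_mono)
  finally show False by (simp add: mult.commute)
qed

text \<open>Method of conditional expectations: fixing one coordinate costs a factor \<open>D\<close> for each of the
  at most \<open>D\<close> functions depending on it, and nothing for the others.\<close>

lemma simultaneous_choice:
  fixes g :: "'i \<Rightarrow> ('v \<Rightarrow> 'x) \<Rightarrow> real"
  assumes "finite V" and X: "finite X" "X \<noteq> {}"
    and nn: "\<And>i a. 0 \<le> g i a"
    and local: "\<And>i v a x. v \<notin> S i \<Longrightarrow> g i (a(v := x)) = g i a"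
    and deg: "\<And>v. finite {i \<in> I. v \<in> S i} \<and> card {i \<in> I. v \<in> S i} \<le> D"
  shows "\<exists>a. (\<forall>v\<in>V. a v \<in> X) \<and> (\<forall>v. v \<notin> V \<longrightarrow> a v = a0 v) \<and>
    (\<forall>i\<in>I. g i a \<le> real D ^ card (S i \<inter> V) * mean_over X V (g i) a0)"
  using assms(1)
proof (induction V arbitrary: a0 rule: finite_induct)
  case empty
  show ?case by (intro exI[of _ a0]) simp
next
  case (insert v V)
  let ?J = "{i \<in> I. v \<in> S i}"
  obtain x where x: "x \<in> X"
    and xJ: "\<And>i. i \<in> ?J \<Longrightarrow> mean_over X V (g i) (a0(v := x)) \<le> D * mean_over X (insert v V) (g i) a0"
  proof -
    have "\<exists>x\<in>X. \<forall>i\<in>?J. mean_over X V (g i) (a0(v := x))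
        \<le> D * ((\<Sum>x\<in>X. mean_over X V (g i) (a0(v := x))) / card X)"
      using deg X by (intro mean_simultaneous_bound mean_over_nonneg[OF insert.hyps(1)] nn) auto
    then show thesis using that by (auto simp: mean_over_insert[OF insert.hyps])
  qed
  have eq: "mean_over X V (g i) (a0(v := x)) = mean_over X (insert v V) (g i) a0" if "v \<notin> S i" for i
    using mean_over_irrelevant_upd[OF insert.hyps(1) local[OF that]] X insert.hyps
    by (simp add: mean_over_insert)
  obtain a where a: "\<forall>w\<in>V. a w \<in> X" "\<forall>w. w \<notin> V \<longrightarrow> a w = (a0(v := x)) w"
    and ga: "\<forall>i\<in>I. g i a \<le> real D ^ card (S i \<inter> V) * mean_over X V (g i) (a0(v := x))"
    using insert.IH by blast
  have "g i a \<le> real D ^ card (S i \<inter> insert v V) * mean_over X (insert v V) (g i) a0" if i: "i \<in> I" for i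
  proof (cases "v \<in> S i")
    case True
    have "g i a \<le> real D ^ card (S i \<inter> V) * (D * mean_over X (insert v V) (g i) a0)"
      using ga i True by (intro order_trans[OF bspec[OF ga i]] mult_left_mono xJ) auto
    then show ?thesis using True insert.hyps by (simp add: mult_ac)
  next
    case False
    then show ?thesis using bspec[OF ga i] eq[OF False] by (simp del: fun_upd_apply)
  qed
  moreover have "\<forall>w\<in>insert v V. a w \<in> X" "\<forall>w. w \<notin> insert v V \<longrightarrow> a w = a0 w"
    using a x insert.hyps by auto
  ultimately show ?case by blast
qed

section \<open>Faces of the simplex and their images\<close>

definition vertex_face :: "nat \<Rightarrow> nat set \<Rightarrow> (nat \<Rightarrow> real) set" where
  "vertex_face N T = {x \<in> standard_simplex N. \<forall>i. i \<notin> T \<longrightarrow> x i = 0}"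

lemma vertex_face_mono: "S \<subseteq> T \<Longrightarrow> vertex_face N S \<subseteq> vertex_face N T"
  by (auto simp: vertex_face_def)

text \<open>Points of the simplex vanish beyond \<open>N\<close>, so arbitrary index sets yield only
  finitely many faces.\<close>

lemma vertex_face_Int: "vertex_face N (T \<inter> {..N}) = vertex_face N T"
  by (force simp: vertex_face_def standard_simplex_def)

lemma compact_standard_simplex: "compact (standard_simplex N)"
  using compactin_standard_simplex[of N] by (simp add: euclidean_product_topology)

lemma compact_vertex_face: "compact (vertex_face N T)"
proof -
  have "closed {x :: nat \<Rightarrow> real. \<forall>i. i \<notin> T \<longrightarrow> x i = 0}"
    by (intro closed_Collect_all closed_Collect_imp open_Collect_const closed_Collect_eq
        continuous_on_const continuous_on_product_coordinates)
  then have "compact (standard_simplex N \<inter> {x. \<forall>i. i \<notin> T \<longrightarrow> x i = 0})"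
    by (intro compact_Int_closed compact_standard_simplex)
  then show ?thesis by (simp add: vertex_face_def Int_def)
qed

text \<open>The images of the faces missing \<open>y\<close> form a finite union of closed sets, so
  its complement \<open>U y\<close> is an open neighbourhood of \<open>y\<close>. These sets cover
  \<open>C\<close>, and \<open>e\<close> is a Lebesgue number of the cover.\<close>

lemma image_vertex_face_small_ball:
  fixes f :: "(nat \<Rightarrow> real) \<Rightarrow> 'b::metric_space"
  assumes f: "continuous_on (standard_simplex N) f" and C: "compact C"
  obtains e where "0 < e" and "\<And>x. x \<in> C \<Longrightarrow>
    \<exists>y. \<forall>T. f ` vertex_face N T \<inter> ball x e \<noteq> {} \<longrightarrow> y \<in> f ` vertex_face N T"
proof -
  have cl: "closed (f ` vertex_face N T)" for T
    using continuous_on_subset[OF f] compact_vertex_face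
    by (intro compact_imp_closed compact_continuous_image) (auto simp: vertex_face_def)
  define U where "U y = - \<Union>{f ` vertex_face N T |T. T \<subseteq> {..N} \<and> y \<notin> f ` vertex_face N T}" for y
  have "open (U y)" for y
  proof -
    have "finite {f ` vertex_face N T |T. T \<subseteq> {..N} \<and> y \<notin> f ` vertex_face N T}"
      by (rule finite_subset[of _ "(\<lambda>T. f ` vertex_face N T) ` Pow {..N}"]) auto
    then show ?thesis unfolding U_def using cl by (intro open_Compl closed_Union) auto
  qed
  moreover have "C \<subseteq> \<Union>(range U)" by (auto simp: U_def)
  ultimately obtain e where e: "0 < e" "\<And>x. x \<in> C \<Longrightarrow> \<exists>G\<in>range U. ball x e \<subseteq> G"
    using Heine_Borel_lemma[OF C] by (metis (no_types, lifting) imageE)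
  have "\<exists>y. \<forall>T. f ` vertex_face N T \<inter> ball x e \<noteq> {} \<longrightarrow> y \<in> f ` vertex_face N T" if x: "x \<in> C" for x
  proof -
    obtain y where y: "ball x e \<subseteq> U y" using e(2)[OF x] by auto
    have "y \<in> f ` vertex_face N T" if "f ` vertex_face N T \<inter> ball x e \<noteq> {}" for T
    proof (rule ccontr)
      assume "y \<notin> f ` vertex_face N T"
      then have "f ` vertex_face N (T \<inter> {..N}) \<in>
          {f ` vertex_face N T |T. T \<subseteq> {..N} \<and> y \<notin> f ` vertex_face N T}"
        by (intro CollectI exI[of _ "T \<inter> {..N}"]) (simp add: vertex_face_Int)
      then have "f ` vertex_face N T \<inter> U y = {}"
        unfolding U_def vertex_face_Int by blast
      then show False using that y by blast
    qed
    then show ?thesis by blast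
  qed
  then show thesis using that e(1) by blast
qed

section \<open>Cubical grid and interpolation weights\<close>

definition corner :: "('d \<Rightarrow> int) \<Rightarrow> 'd set \<Rightarrow> 'd \<Rightarrow> int" where
  "corner z C = (\<lambda>i. z i + of_bool (i \<in> C))"

lemma inj_corner: "inj (corner z)"
proof (rule injI)
  fix A B assume "corner z A = corner z B"
  then have "of_bool (i \<in> A) = (of_bool (i \<in> B) :: int)" for i
    by (metis corner_def add_left_cancel)
  then show "A = B" by (auto simp: of_bool_eq_iff)
qed

text \<open>A lattice point and the corner it occupies determine the cube. This is the degree bound
  for \<open>simultaneous_choice\<close>.\<close>

lemma card_cubes_at_corner:
  fixes v :: "'d::finite \<Rightarrow> int"
  shows "finite {z \<in> I. v \<in> range (corner z)} \<and> card {z \<in> I. v \<in> range (corner z)} \<le> CARD('d set)"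
proof -
  let ?g = "\<lambda>C i. v i - of_bool (i \<in> C)"
  have "z = ?g A" if "v = corner z A" for z A
    using that by (simp add: corner_def)
  then have sub: "{z \<in> I. v \<in> range (corner z)} \<subseteq> range ?g" by blast
  have "card {z \<in> I. v \<in> range (corner z)} \<le> card (range ?g)"
    by (rule card_mono[OF _ sub]) simp
  also have "\<dots> \<le> CARD('d set)" by (rule card_image_le) simp
  finally show ?thesis using finite_subset[OF sub] by simp
qed

text \<open>A product of tent functions centred at the grid point with coordinates
  \<open>\<delta> * v i\<close>. Interpolation will divide by the sum of these weights, so it is
  enough that one is positive and the others are nonnegative.\<close>

definition hat :: "real \<Rightarrow> real ^ 'd \<Rightarrow> ('d::finite \<Rightarrow> int) \<Rightarrow> real" where
  "hat \<delta> y v = (\<Prod>i\<in>UNIV. max 0 (1 - \<bar>y $ i / \<delta> - v i\<bar>))"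

lemma hat_nonneg: "0 \<le> hat \<delta> y v"
  by (simp add: hat_def prod_nonneg)

lemma hat_floor_pos: "0 < hat \<delta> y (\<lambda>i. \<lfloor>y $ i / \<delta>\<rfloor>)"
  unfolding hat_def by (intro prod_pos) (auto simp: max_def abs_if, linarith+)

lemma hat_nonzero_corner:
  assumes "hat \<delta> y v \<noteq> 0"
  shows "v \<in> range (corner (\<lambda>i. \<lfloor>y $ i / \<delta>\<rfloor>))"
proof -
  have *: "v i = \<lfloor>y $ i / \<delta>\<rfloor> \<or> v i = \<lfloor>y $ i / \<delta>\<rfloor> + 1" for i
  proof -
    have "max 0 (1 - \<bar>y $ i / \<delta> - v i\<bar>) \<noteq> 0"
      using assms unfolding hat_def by (metis UNIV_I finite prod_zero_iff)
    then show ?thesis by (simp add: max_def abs_if split: if_splits) linarith+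
  qed
  have "v = corner (\<lambda>i. \<lfloor>y $ i / \<delta>\<rfloor>) {i. v i \<noteq> \<lfloor>y $ i / \<delta>\<rfloor>}"
    using * by (auto simp: corner_def fun_eq_iff)
  then show ?thesis by blast
qed

lemma continuous_on_hat: "continuous_on S (\<lambda>y. hat \<delta> y v)"
  unfolding hat_def divide_inverse by (intro continuous_intros)

section \<open>Selection of a point hit by many faces\<close>

text \<open>The \<open>2 ^ d\<close>-tuples of vertices are functions \<open>'d set \<Rightarrow> nat\<close>, because subsets of the coordinates index
  the corners of a cube. They may repeat vertices.\<close>

lemma selection:
  fixes f :: "(nat \<Rightarrow> real) \<Rightarrow> real ^ 'd"
  assumes f: "continuous_on (standard_simplex N) f" and X: "X \<subseteq> {..N}" "X \<noteq> {}"
  defines "D \<equiv> CARD('d set)"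
  shows "\<exists>y. 1 / real D ^ D \<le>
    mean_over X (UNIV :: 'd set set) (\<lambda>t. of_bool (y \<in> f ` vertex_face N (range t))) (\<lambda>_. 0)"
proof (rule ccontr)
  assume "\<not> ?thesis"
  \<comment> \<open>The bound \<open>1 / real D ^ D\<close> offsets the loss in
    \<open>simultaneous_choice\<close>: a cube has \<open>D\<close> corners, each lying in at most
    \<open>D\<close> cubes.\<close>
  then have few: "mean_over X (UNIV :: 'd set set)
      (\<lambda>t. of_bool (y \<in> f ` vertex_face N (range t))) (\<lambda>_. 0) < 1 / real D ^ D" for y
    by (auto simp: not_le)
  have finX: "finite X" using X finite_subset by blast
  have D: "D > 0" by (simp add: D_def)
  have "bounded (f ` standard_simplex N)"
    using f compact_standard_simplex by (intro compact_imp_bounded compact_continuous_image)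
  then obtain R where R: "R > 0" "f ` standard_simplex N \<subseteq> cball 0 R"
    unfolding bounded_pos by (metis image_subset_iff mem_cball_0 imageI)
  define C where "C = cball (0 :: real ^ 'd) R"
  obtain e where e: "0 < e" "\<And>x. x \<in> C \<Longrightarrow>
      \<exists>y. \<forall>T. f ` vertex_face N T \<inter> ball x e \<noteq> {} \<longrightarrow> y \<in> f ` vertex_face N T"
    using image_vertex_face_small_ball[OF f, of C] by (auto simp: C_def)
  \<comment> \<open>Points of one cell differ by at most \<open>\<delta>\<close> in each coordinate,
    so their distance is at most \<open>e / 2\<close>.\<close>
  define \<delta> where "\<delta> = e / (2 * CARD('d))"
  have \<delta>: "\<delta> > 0" using e by (simp add: \<delta>_def)
  define fl where "fl y = (\<lambda>i. \<lfloor>y $ i / \<delta>\<rfloor>)" for y :: "real ^ 'd"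
  define cell where "cell z = {y \<in> C. fl y = z}" for z
  have cell_small: "cell z \<subseteq> ball x e" if "x \<in> cell z" for x z
  proof
    fix y assume y: "y \<in> cell z"
    have "\<bar>(x - y) $ i\<bar> \<le> \<delta>" for i
    proof -
      have "\<lfloor>x $ i / \<delta>\<rfloor> = \<lfloor>y $ i / \<delta>\<rfloor>"
        using that y by (auto simp: cell_def fl_def fun_eq_iff)
      then have "\<bar>x $ i / \<delta> - y $ i / \<delta>\<bar> \<le> 1" by linarith
      then show ?thesis using \<delta> by (simp add: field_simps abs_le_iff)
    qed
    then have "norm (x - y) \<le> (\<Sum>i\<in>(UNIV :: 'd set). \<delta>)"
      by (intro order_trans[OF norm_le_l1_cart] sum_mono)
    also have "\<dots> < e" using e by (simp add: \<delta>_def)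
    finally show "y \<in> ball x e" by (simp add: dist_norm)
  qed
  \<comment> \<open>The extra 1 makes room for upper corners, so that \<open>V\<close> contains all
    corners of cells meeting \<open>C\<close>.\<close>
  define M where "M = \<lceil>R / \<delta>\<rceil> + 1"
  define V where "V = {v :: 'd \<Rightarrow> int. \<forall>i. v i \<in> {- M..M}}"
  have "V = PiE UNIV (\<lambda>_. {- M..M})" by (auto simp: V_def)
  then have finV: "finite V" by (simp add: finite_PiE)
  have corner_V: "corner (fl y) A \<in> V" if "y \<in> C" for y A
  proof -
    have "- M \<le> corner (fl y) A i \<and> corner (fl y) A i \<le> M" for i
    proof -
      have "\<bar>y $ i\<bar> \<le> R"
        using that component_le_norm_cart[of y i] by (simp add: C_def)
      then have "\<bar>y $ i / \<delta>\<bar> \<le> R / \<delta>" using \<delta> by (simp add: divide_right_mono)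
      then have "- M \<le> \<lfloor>y $ i / \<delta>\<rfloor>" "\<lfloor>y $ i / \<delta>\<rfloor> + 1 \<le> M"
        unfolding M_def by linarith+
      then show ?thesis by (simp add: corner_def fl_def)
    qed
    then show ?thesis by (simp add: V_def)
  qed
  define bad where "bad z t = (of_bool (f ` vertex_face N (range t) \<inter> cell z \<noteq> {}) :: real)"
    for z and t :: "'d set \<Rightarrow> nat"
  \<comment> \<open>Grid points are labelled by vertices from \<open>X\<close>, for all cells at
    once; \<open>bad z\<close> depends only on the labels at the corners of the cube
    \<open>z\<close>.\<close>
  have "\<exists>a. (\<forall>v\<in>V. a v \<in> X) \<and> (\<forall>v. v \<notin> V \<longrightarrow> a v = (\<lambda>_. 0) v) \<and>
    (\<forall>z\<in>fl ` C. bad z (a \<circ> corner z) \<le> real D ^ card (range (corner z) \<inter> V) *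
       mean_over X V (\<lambda>a. bad z (a \<circ> corner z)) (\<lambda>_. 0))"
  proof (rule simultaneous_choice[OF finV finX X(2)])
    show "0 \<le> bad z (a \<circ> corner z)" for z a by (simp add: bad_def)
    show "bad z (a(v := x) \<circ> corner z) = bad z (a \<circ> corner z)" if "v \<notin> range (corner z)" for z v a x
    proof -
      have "a(v := x) \<circ> corner z = a \<circ> corner z" using that by (intro ext) (metis comp_apply fun_upd_other rangeI)
      then show ?thesis by metis
    qed
  qed (use card_cubes_at_corner in \<open>auto simp: D_def\<close>)
  then obtain a where aX: "\<And>v. v \<in> V \<Longrightarrow> a v \<in> X"
    and a: "\<And>z. z \<in> fl ` C \<Longrightarrow> bad z (a \<circ> corner z) \<le> real D ^ card (range (corner z) \<inter> V) *
       mean_over X V (\<lambda>a. bad z (a \<circ> corner z)) (\<lambda>_. 0)"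
    by blast
  have good: "f ` vertex_face N (range (a \<circ> corner (fl x))) \<inter> cell (fl x) = {}" if x: "x \<in> C" for x
  proof -
    let ?z = "fl x"
    obtain y where y: "\<And>T. f ` vertex_face N T \<inter> ball x e \<noteq> {} \<Longrightarrow> y \<in> f ` vertex_face N T"
      using e(2)[OF x] by blast
    have sub: "range (corner ?z) \<subseteq> V" using corner_V[OF x] by blast
    have "cell ?z \<subseteq> ball x e" using x by (intro cell_small) (simp add: cell_def)
    \<comment> \<open>A face whose image meets the cell also meets the ball, so its image contains
      \<open>y\<close>: a bound for a single point controls the whole cell.\<close>
    then have le: "bad ?z t \<le> of_bool (y \<in> f ` vertex_face N (range t))" for t
      using y[of "range t"] unfolding bad_def by fastforce
    have "mean_over X V (\<lambda>a. bad ?z (a \<circ> corner ?z)) (\<lambda>_. 0)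
        = mean_over X (corner ?z -` V) (bad ?z) ((\<lambda>_. 0) \<circ> corner ?z)"
      by (rule mean_over_comp[OF finV finX X(2) inj_corner])
    also have "corner ?z -` V = UNIV" using sub by blast
    also have "(\<lambda>_. 0) \<circ> corner ?z = (\<lambda>_. 0)" by (simp add: o_def)
    also have "mean_over X UNIV (bad ?z) (\<lambda>_. 0)
        \<le> mean_over X (UNIV :: 'd set set) (\<lambda>t. of_bool (y \<in> f ` vertex_face N (range t))) (\<lambda>_. 0)"
      by (intro mean_over_mono le) simp
    also have "\<dots> < 1 / real D ^ D" by (rule few)
    finally have "real D ^ D * mean_over X V (\<lambda>a. bad ?z (a \<circ> corner ?z)) (\<lambda>_. 0) < 1"
      using D by (simp add: field_simps del: o_apply)
    moreover have "card (range (corner ?z) \<inter> V) = D"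
      using sub by (simp add: Int_absorb2 card_image inj_corner D_def)
    \<comment> \<open>\<open>bad\<close> takes only the values 0 and 1, so a value below 1 means
      that the cell is missed.\<close>
    ultimately have "bad ?z (a \<circ> corner ?z) < 1" using a[of ?z] x by simp
    then show ?thesis by (simp add: bad_def split: if_splits)
  qed
  define s where "s y = (\<Sum>v\<in>V. hat \<delta> y v)" for y
  have s: "s y > 0" if "y \<in> C" for y
  proof -
    have "fl y \<in> V" using corner_V[OF that, of "{}"] by (simp add: corner_def)
    then show ?thesis
      unfolding s_def using finV hat_floor_pos[of \<delta> y]
      by (intro sum_pos2[of V "fl y"]) (auto simp: fl_def hat_nonneg)
  qed
  \<comment> \<open>The grid point \<open>v\<close> is sent to the vertex \<open>a v\<close>, with
    normalised hats as interpolation weights; coordinate \<open>j\<close> collects the weights of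
    all grid points labelled \<open>j\<close>.\<close>
  define h where "h y = (\<lambda>j. (\<Sum>v\<in>V. hat \<delta> y v * of_bool (a v = j)) / s y)" for y
  have h: "h y \<in> standard_simplex N" if "y \<in> C" for y
  proof -
    have tot: "(\<Sum>j\<le>N. h y j) = 1"
    proof -
      have "(\<Sum>j\<le>N. \<Sum>v\<in>V. hat \<delta> y v * of_bool (a v = j))
          = (\<Sum>v\<in>V. \<Sum>j\<le>N. hat \<delta> y v * of_bool (a v = j))"
        by (rule sum.swap)
      also have "\<dots> = s y"
        unfolding s_def using aX X(1)
        by (intro sum.cong refl) (auto simp: of_bool_def if_distrib cong: if_cong)
      finally show ?thesis using s[OF that] by (simp add: h_def flip: sum_divide_distrib)
    qed
    have nn: "0 \<le> h y j" for j
      using s[OF that] by (auto simp: h_def intro!: divide_nonneg_pos sum_nonneg hat_nonneg)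
    have z: "h y j = 0" if "j > N" for j
    proof -
      have "a v \<noteq> j" if "v \<in> V" for v using aX[OF that] X(1) \<open>j > N\<close> by auto
      then show ?thesis by (simp add: h_def)
    qed
    have "h y j \<le> 1" for j
    proof (cases "j \<le> N")
      case True
      then show ?thesis using member_le_sum[of j "{..N}" "h y"] nn tot by auto
    qed (simp add: z)
    then show ?thesis using tot nn z by (simp add: standard_simplex_def)
  qed
  \<comment> \<open>Only corners of the cell of \<open>y\<close> carry weight at
    \<open>y\<close>.\<close>
  have hf: "h y \<in> vertex_face N (range (a \<circ> corner (fl y)))" if "y \<in> C" for y
  proof -
    have "h y j = 0" if j: "j \<notin> range (a \<circ> corner (fl y))" for j
    proof -
      have "hat \<delta> y v * of_bool (a v = j) = 0" for v
        using hat_nonzero_corner[of \<delta> y v] j by (auto simp: fl_def)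
      then have "(\<Sum>v\<in>V. hat \<delta> y v * of_bool (a v = j)) = 0" by (intro sum.neutral) blast
      then show ?thesis by (simp add: h_def)
    qed
    then show ?thesis using h[OF that] by (simp add: vertex_face_def)
  qed
  have "continuous_on C h"
  proof (rule continuous_on_coordinatewise_then_product)
    show "continuous_on C (\<lambda>y. h y j)" for j
      unfolding h_def s_def
    proof (intro continuous_intros continuous_on_hat)
      show "\<forall>y\<in>C. sum (hat \<delta> y) V \<noteq> 0" using s by (force simp: s_def)
    qed
  qed
  then have "continuous_on C (f \<circ> h)"
    using h by (intro continuous_on_compose continuous_on_subset[OF f]) auto
  moreover have "f \<circ> h \<in> C \<rightarrow> C" using h R by (auto simp: C_def)
  ultimately obtain y where y: "y \<in> C" "(f \<circ> h) y = y"
    using brouwer[of C "f \<circ> h"] R by (auto simp: C_def)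
  \<comment> \<open>The fixed point \<open>y = f (h y)\<close> lies in its own cell and in the image
    of the face spanned by the labels at the corners of that cell, which \<open>good\<close>
    excludes.\<close>
  then have "y \<in> f ` vertex_face N (range (a \<circ> corner (fl y))) \<inter> cell (fl y)"
    using hf[OF y(1)] by (auto simp: cell_def intro: image_eqI[of _ _ "h y"])
  then show False using good[OF y(1)] by blast
qed

section \<open>Greedy choice of the piercing points\<close>

theorem proposition9:
  fixes \<epsilon> :: real
  assumes "0 < \<epsilon>" and "\<epsilon> < 1"
  shows "\<exists>p::nat. \<forall>N::nat. \<forall>f :: (nat \<Rightarrow> real) \<Rightarrow> real ^ 'd.
           continuous_on (standard_simplex N) f \<longrightarrow>
           (\<exists>y :: nat \<Rightarrow> real ^ 'd.
              \<forall>F. simplex_face N (nat \<lceil>\<epsilon> * real N\<rceil>) F \<longrightarrow>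
                (\<Union>i\<in>{1..p}. {x \<in> standard_simplex N. f x = y i}) \<inter> F \<noteq> {})"
proof -
  define D where "D = CARD('d set)"
  \<comment> \<open>The factor \<open>1 / real D ^ D\<close> comes from selection inside a missed
    face; \<open>\<epsilon> ^ D\<close> bounds from below the fraction of tuples with all entries in
    that face.\<close>
  define c where "c = \<epsilon> ^ D * (1 / real D ^ D)"
  have c: "c > 0" using assms by (simp add: c_def D_def)
  \<comment> \<open>Large enough that \<open>p\<close> gains of size \<open>c\<close> would exceed
    1.\<close>
  define p where "p = nat \<lceil>1 / c\<rceil> + 1"
  have "1 / c < p" unfolding p_def by linarith
  then have p: "1 < p * c" using c by (simp add: field_simps)
  have "\<exists>y :: nat \<Rightarrow> real ^ 'd. \<forall>F. simplex_face N (nat \<lceil>\<epsilon> * real N\<rceil>) F \<longrightarrow>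
      (\<Union>i\<in>{1..p}. {x \<in> standard_simplex N. f x = y i}) \<inter> F \<noteq> {}"
    if f: "continuous_on (standard_simplex N) f" for N and f :: "(nat \<Rightarrow> real) \<Rightarrow> real ^ 'd"
  proof -
    define cov where "cov Y t = (of_bool (Y \<inter> f ` vertex_face N (range t) \<noteq> {}) :: real)"
      for Y and t :: "'d set \<Rightarrow> nat"
    \<comment> \<open>The potential of the greedy argument, a fraction of all tuples and hence at
      most 1.\<close>
    define \<Phi> where "\<Phi> Y = mean_over {..N} UNIV (cov Y) (\<lambda>_. 0)" for Y
    define piercing where "piercing Y \<longleftrightarrow> (\<forall>S. S \<subseteq> {..N} \<and> card S = nat \<lceil>\<epsilon> * real N\<rceil> + 1
      \<longrightarrow> Y \<inter> f ` vertex_face N S \<noteq> {})" for Y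
    have step: "\<exists>y. \<Phi> Y + c \<le> \<Phi> (insert y Y)" if Y: "\<not> piercing Y" for Y
    proof -
      obtain S where S: "S \<subseteq> {..N}" "card S = nat \<lceil>\<epsilon> * real N\<rceil> + 1"
        and disj: "Y \<inter> f ` vertex_face N S = {}"
        using Y unfolding piercing_def by blast
      have "S \<noteq> {}" using S(2) by auto
      then obtain y where y: "1 / real D ^ D \<le>
          mean_over S UNIV (\<lambda>t :: 'd set \<Rightarrow> nat. of_bool (y \<in> f ` vertex_face N (range t))) (\<lambda>_. 0)"
        using selection[OF f S(1)] unfolding D_def by blast
      \<comment> \<open>The tuples gained by \<open>y\<close>, counted among all tuples and not only
        those from \<open>S\<close>, so that the count adds to \<open>cov Y\<close>.\<close>
      define new where "new t = (of_bool (y \<in> f ` vertex_face N (range t) \<and>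
        Y \<inter> f ` vertex_face N (range t) = {}) :: real)" for t :: "'d set \<Rightarrow> nat"
      \<comment> \<open>A face has one vertex more than its dimension; with
        \<open>\<epsilon> < 1\<close> this turns a fraction of \<open>N\<close> into a fraction of
        the \<open>N + 1\<close> vertices.\<close>
      have "\<epsilon> * N + 1 \<le> card S" using S(2) assms by (simp add: real_nat_ceiling_ge)
      then have "\<epsilon> * (N + 1) \<le> card S" using assms by (simp add: algebra_simps)
      then have "\<epsilon> \<le> card S / card {..N}" by (simp add: field_simps)
      then have "\<epsilon> ^ D \<le> (card S / card {..N}) ^ D"
        using assms by (intro power_mono) auto
      \<comment> \<open>A tuple from \<open>S\<close> spans a subface of the missed face, so every
        such tuple hit by \<open>y\<close> is newly covered.\<close>
      moreover have "1 / real D ^ D \<le> mean_over S UNIV new (\<lambda>_. 0)"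
      proof (rule order_trans[OF y mean_over_mono])
        fix t :: "'d set \<Rightarrow> nat" assume "\<And>A. A \<in> UNIV \<Longrightarrow> t A \<in> S"
        then have "vertex_face N (range t) \<subseteq> vertex_face N S"
          by (intro vertex_face_mono) auto
        then show "of_bool (y \<in> f ` vertex_face N (range t)) \<le> new t"
          using disj unfolding new_def by fastforce
      qed simp
      ultimately have "c \<le> (card S / card {..N}) ^ D * mean_over S UNIV new (\<lambda>_. 0)"
        unfolding c_def by (intro mult_mono) auto
      also have "\<dots> \<le> mean_over {..N} UNIV new (\<lambda>_. 0)"
        unfolding D_def using S(1) \<open>S \<noteq> {}\<close> by (intro mean_over_subset) (auto simp: new_def)
      finally have "\<Phi> Y + c \<le> mean_over {..N} UNIV (\<lambda>t. cov Y t + new t) (\<lambda>_. 0)"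
        by (simp add: mean_over_add \<Phi>_def)
      also have "\<dots> \<le> \<Phi> (insert y Y)"
        unfolding \<Phi>_def by (rule mean_over_mono) (auto simp: cov_def new_def)
      finally show ?thesis by blast
    qed
    \<comment> \<open>Adding points preserves piercing, so the first alternative persists and the
      number of points can be exactly \<open>n\<close>.\<close>
    have greedy: "\<exists>y. piercing (y ` {1..n}) \<or> n * c \<le> \<Phi> (y ` {1..n})" for n :: nat
    proof (induction n)
      case 0
      have "0 \<le> \<Phi> {}" unfolding \<Phi>_def by (rule mean_over_nonneg) (auto simp: cov_def)
      then show ?case by simp
    next
      case (Suc n)
      then obtain y where y: "piercing (y ` {1..n}) \<or> n * c \<le> \<Phi> (y ` {1..n})" by blast
      show ?case
      proof (cases "piercing (y ` {1..n})")
        case True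
        then have "piercing (y ` {1..Suc n})"
          unfolding piercing_def by (simp add: atLeastAtMostSuc_conv)
        then show ?thesis by blast
      next
        case False
        then obtain z where z: "\<Phi> (y ` {1..n}) + c \<le> \<Phi> (insert z (y ` {1..n}))" using step by blast
        have "(y(Suc n := z)) ` {1..Suc n} = insert z (y ` {1..n})"
          by (auto simp: atLeastAtMostSuc_conv image_iff)
        moreover have "Suc n * c \<le> \<Phi> (insert z (y ` {1..n}))"
          using z y False by (simp add: algebra_simps)
        ultimately show ?thesis by (metis (no_types, lifting))
      qed
    qed
    have "\<Phi> Y \<le> mean_over {..N} UNIV (\<lambda>_ :: 'd set \<Rightarrow> nat. 1) (\<lambda>_. 0)" for Y
      unfolding \<Phi>_def by (rule mean_over_mono) (auto simp: cov_def)
    then have "\<Phi> Y \<le> 1" for Y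
      by (simp add: mean_over_const)
    \<comment> \<open>After \<open>p\<close> rounds the second alternative would push
      \<open>\<Phi>\<close> above 1.\<close>
    then obtain y where y: "piercing (y ` {1..p})"
      using greedy[of p] p by (meson less_le_trans not_less)
    have "(\<Union>i\<in>{1..p}. {x \<in> standard_simplex N. f x = y i}) \<inter> F \<noteq> {}"
      if sF: "simplex_face N (nat \<lceil>\<epsilon> * real N\<rceil>) F" for F
    proof -
      obtain S where "S \<subseteq> {..N}" "card S = nat \<lceil>\<epsilon> * real N\<rceil> + 1" and F: "F = vertex_face N S"
        using sF by (auto simp: simplex_face_def vertex_face_def)
      then have "y ` {1..p} \<inter> f ` F \<noteq> {}" using y unfolding piercing_def by blast
      moreover have "F \<subseteq> standard_simplex N" by (auto simp: F vertex_face_def)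
      ultimately show ?thesis by fastforce
    qed
    then show ?thesis by blast
  qed
  then show ?thesis by blast
qed

end
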